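(* Let $\Gamma\in\mathscr G_3$ have coherent rank $9$. Then the coherent closure $\mathcal W(\Gamma)$ has type $\begin{bmatrix}2&2\\ &3\end{bmatrix}$.
   Context: All graphs are finite, undirected and simple; the eigenvalues of a graph are those of its adjacency matrix $A(\Gamma)$. $\mathscr G_3$ denotes the set of all connected graphs having precisely three distinct eigenvalues. A coherent algebra on a finite set $X$ is a matrix algebra $\mathcal A\subset \operatorname{Mat}_X(\mathbb C)$ that contains the identity matrix $I$ and the all-ones matrix $J$, and is closed under transposition, ordinary matrix multiplication and entrywise multiplication. Each coherent algebra has a unique linear basis $\{A_1,\dots,A_r\}$ consisting of $\{0,1\}$-matrices with $\sum_i A_i=J$; the number $r$ is the rank of $\mathcal A$. Some of the $A_i$ are diagonal and sum to $I$; the supports (in $X$) of these diagonal basis matrices are the fibres $X_1,\dots,X_f$, which partition $X$. Each $A_k$ is supported in a single block $X_i\times X_j$. The type of $\mathcal A$ is the symmetric matrix $(t_{ij})$ where $t_{ij}$ is the number of basis matrices supported in $X_i\times X_j$; it is taken up to reordering the fibres, and entries below the diagonal are omitted. The coherent closure $\mathcal W(\Gamma)$ of $\Gamma$ is the smallest coherent algebra containing $A(\Gamma)$, and the coherent rank of $\Gamma$ is the rank of $\mathcal W(\Gamma)$ (the sum of all entries of its type matrix). *)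

theory Defs
  imports "HOL-Analysis.Analysis"
begin

text \<open>The vertex set of a graph is a finite type \<open>'v\<close>, and the graph is given by its adjacency
  relation.\<close>

definition simple_graph :: "('v::finite \<Rightarrow> 'v \<Rightarrow> bool) \<Rightarrow> bool" where
  "simple_graph E \<longleftrightarrow> symp E \<and> irreflp E"

definition connected_graph :: "('v::finite \<Rightarrow> 'v \<Rightarrow> bool) \<Rightarrow> bool" where
  "connected_graph E \<longleftrightarrow> simple_graph E \<and> (\<forall>x y. E\<^sup>*\<^sup>* x y)"

definition adjacency_matrix :: "('v::finite \<Rightarrow> 'v \<Rightarrow> bool) \<Rightarrow> complex^'v^'v" where
  "adjacency_matrix E = (\<chi> x y. if E x y then 1 else 0)"

definition eigenvalues :: "complex^'v^'v::finite \<Rightarrow> complex set" where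
  "eigenvalues M = {c. \<exists>v. v \<noteq> 0 \<and> M *v v = c *s v}"

definition three_eigenvalue_graph :: "('v::finite \<Rightarrow> 'v \<Rightarrow> bool) \<Rightarrow> bool" where
  "three_eigenvalue_graph E \<longleftrightarrow>
     connected_graph E \<and> card (eigenvalues (adjacency_matrix E)) = 3"

definition all_ones :: "complex^'v^'v::finite" where
  "all_ones = (\<chi> x y. 1)"

definition entrywise_mult :: "complex^'v^'v \<Rightarrow> complex^'v^'v \<Rightarrow> complex^'v^'v::finite" where
  "entrywise_mult M N = (\<chi> x y. M $ x $ y * N $ x $ y)"

definition scale_matrix :: "complex \<Rightarrow> complex^'v^'v \<Rightarrow> complex^'v^'v::finite" where
  "scale_matrix c M = (\<chi> x y. c * M $ x $ y)"

global_interpretation cmat: vector_space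
  "scale_matrix :: complex \<Rightarrow> complex^'v^'v \<Rightarrow> complex^'v^'v::finite"
  by unfold_locales (auto simp: scale_matrix_def vec_eq_iff algebra_simps)

definition coherent_algebra :: "(complex^'v^'v::finite) set \<Rightarrow> bool" where
  "coherent_algebra W \<longleftrightarrow>
     cmat.subspace W \<and> mat 1 \<in> W \<and> all_ones \<in> W \<and>
     (\<forall>M\<in>W. transpose M \<in> W) \<and>
     (\<forall>M\<in>W. \<forall>N\<in>W. M ** N \<in> W) \<and>
     (\<forall>M\<in>W. \<forall>N\<in>W. entrywise_mult M N \<in> W)"

definition zero_one_matrix :: "complex^'v^'v::finite \<Rightarrow> bool" where
  "zero_one_matrix M \<longleftrightarrow> (\<forall>x y. M $ x $ y \<in> {0, 1})"

definition is_standard_basis :: "(complex^'v^'v::finite) set \<Rightarrow> (complex^'v^'v) set \<Rightarrow> bool" where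
  "is_standard_basis W B \<longleftrightarrow>
     cmat.independent B \<and> cmat.span B = W \<and> (\<forall>M\<in>B. zero_one_matrix M) \<and> \<Sum>B = all_ones"

definition standard_basis :: "(complex^'v^'v::finite) set \<Rightarrow> (complex^'v^'v) set" where
  "standard_basis W = (THE B. is_standard_basis W B)"

definition coherent_closure :: "('v::finite \<Rightarrow> 'v \<Rightarrow> bool) \<Rightarrow> (complex^'v^'v) set" where
  "coherent_closure E = \<Inter>{W. coherent_algebra W \<and> adjacency_matrix E \<in> W}"

definition algebra_rank :: "(complex^'v^'v::finite) set \<Rightarrow> nat" where
  "algebra_rank W = card (standard_basis W)"

definition coherent_rank :: "('v::finite \<Rightarrow> 'v \<Rightarrow> bool) \<Rightarrow> nat" where
  "coherent_rank E = algebra_rank (coherent_closure E)"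

definition diagonal_matrix :: "complex^'v^'v::finite \<Rightarrow> bool" where
  "diagonal_matrix M \<longleftrightarrow> (\<forall>x y. x \<noteq> y \<longrightarrow> M $ x $ y = 0)"

definition fibres :: "(complex^'v^'v::finite) set \<Rightarrow> 'v set set" where
  "fibres W = {{x. M $ x $ x \<noteq> 0} | M. M \<in> standard_basis W \<and> diagonal_matrix M}"

definition block_count :: "(complex^'v^'v::finite) set \<Rightarrow> 'v set \<Rightarrow> 'v set \<Rightarrow> nat" where
  "block_count W F G =
     card {M \<in> standard_basis W. \<forall>x y. M $ x $ y \<noteq> 0 \<longrightarrow> x \<in> F \<and> y \<in> G}"

text \<open>The type matrix is written as the list of its rows, with the entries below the diagonal
  included.  Quantifying over the enumeration \<open>Fs\<close> of the fibres expresses that it is taken up to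
  reordering the fibres.\<close>

definition has_type :: "(complex^'v^'v::finite) set \<Rightarrow> nat list list \<Rightarrow> bool" where
  "has_type W T \<longleftrightarrow>
     (\<exists>Fs. distinct Fs \<and> set Fs = fibres W \<and> T = map (\<lambda>F. map (block_count W F) Fs) Fs)"

lemma coherent_algebra_UNIV: "coherent_algebra UNIV"
  by (simp add: coherent_algebra_def)

lemma coherent_algebra_Inter:
  assumes "\<And>W. W \<in> S \<Longrightarrow> coherent_algebra W"
  shows "coherent_algebra (\<Inter>S)"
  using assms unfolding coherent_algebra_def cmat.subspace_def by blast

lemma coherent_algebra_coherent_closure: "coherent_algebra (coherent_closure E)"
  unfolding coherent_closure_def by (rule coherent_algebra_Inter) blast

lemma adjacency_matrix_in_coherent_closure: "adjacency_matrix E \<in> coherent_closure E"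
  unfolding coherent_closure_def by blast

lemma coherent_closure_least:
  "coherent_algebra W \<Longrightarrow> adjacency_matrix E \<in> W \<Longrightarrow> coherent_closure E \<subseteq> W"
  unfolding coherent_closure_def by blast

lemma zero_one_matrix_iff: "zero_one_matrix M \<longleftrightarrow> (\<forall>x y. M $ x $ y = 0 \<or> M $ x $ y = 1)"
  by (simp add: zero_one_matrix_def)

lemma finite_zero_one_matrices: "finite {M :: complex^'v^'v::finite. zero_one_matrix M}"
proof -
  let ?f = "\<lambda>R::('v \<times> 'v) set. (\<chi> x y. if (x, y) \<in> R then 1 else 0) :: complex^'v^'v"
  have "M \<in> range ?f" if "zero_one_matrix M" for M
  proof -
    have "M = ?f {(x, y). M $ x $ y = 1}"
      using that by (auto simp: vec_eq_iff zero_one_matrix_iff)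
    then show ?thesis by blast
  qed
  then have "{M :: complex^'v^'v. zero_one_matrix M} \<subseteq> range ?f" by blast
  then show ?thesis by (rule finite_subset) simp
qed

lemma standard_basis_cell:
  fixes B :: "(complex^'v^'v::finite) set"
  assumes "is_standard_basis W B"
  shows "\<exists>!M. M \<in> B \<and> M $ x $ y = 1"
proof -
  have zo: "\<And>M. M \<in> B \<Longrightarrow> M $ x $ y = 0 \<or> M $ x $ y = 1" and s: "\<Sum>B = all_ones"
    using assms by (auto simp: is_standard_basis_def zero_one_matrix_iff)
  have fin: "finite B"
    by (rule finite_subset[OF _ finite_zero_one_matrices])
      (use assms in \<open>auto simp: is_standard_basis_def\<close>)
  have "(\<Sum>M\<in>B. M $ x $ y) = \<Sum>B $ x $ y" by simp
  also have "\<dots> = 1" by (simp add: s all_ones_def)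
  also have "(\<Sum>M\<in>B. M $ x $ y) = (\<Sum>M\<in>B. if M $ x $ y = 1 then 1 else 0)"
    using zo by (intro sum.cong) auto
  also have "\<dots> = of_nat (card {M\<in>B. M $ x $ y = 1})"
    using fin by (simp add: sum.If_cases Int_def)
  finally have "card {M\<in>B. M $ x $ y = 1} = 1"
    using of_nat_eq_1_iff by blast
  then obtain N where N: "{M\<in>B. M $ x $ y = 1} = {N}" by (rule card_1_singletonE)
  then have "M \<in> B \<and> M $ x $ y = 1 \<longleftrightarrow> M = N" for M
    by (simp add: set_eq_iff)
  then show ?thesis by simp
qed

lemma standard_basis_cell_unique:
  assumes "is_standard_basis W B" "M \<in> B" "N \<in> B" "M $ x $ y = 1" "N $ x $ y = 1"
  shows "M = N"
proof -
  let ?P = "\<lambda>L. L \<in> B \<and> L $ x $ y = 1"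
  have "(THE L. ?P L) = M"
    by (rule the1_equality[OF standard_basis_cell[OF assms(1)]]) (use assms in simp)
  moreover have "(THE L. ?P L) = N"
    by (rule the1_equality[OF standard_basis_cell[OF assms(1)]]) (use assms in simp)
  ultimately show ?thesis by simp
qed

lemma standard_basis_constant:
  fixes B :: "(complex^'v^'v::finite) set"
  assumes "is_standard_basis W B" "N \<in> W" "M \<in> B" "M $ x $ y = 1" "M $ u $ v = 1"
  shows "N $ x $ y = N $ u $ v"
proof -
  have "N \<in> cmat.span B" using assms by (auto simp: is_standard_basis_def)
  then show ?thesis
  proof (induction rule: cmat.span_induct)
    case base
    show ?case by (auto simp: cmat.subspace_def scale_matrix_def)
  next
    case (step L)
    show ?case
    proof (cases "L = M")
      case False
      then have "L $ x $ y \<noteq> 1" "L $ u $ v \<noteq> 1"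
        using standard_basis_cell_unique[OF assms(1) step(1) assms(3)] assms(4,5) by auto
      moreover have "zero_one_matrix L"
        using step assms(1) by (simp add: is_standard_basis_def)
      ultimately have "L $ x $ y = 0" "L $ u $ v = 0" by (auto simp: zero_one_matrix_iff)
      then show ?thesis by simp
    qed (use assms in simp)
  qed
qed

lemma standard_basis_subset:
  fixes B B' :: "(complex^'v^'v::finite) set"
  assumes B: "is_standard_basis W B" and B': "is_standard_basis W B'"
  shows "B \<subseteq> B'"
proof
  fix M assume M: "M \<in> B"
  have zo: "\<And>N. N \<in> B \<union> B' \<Longrightarrow> zero_one_matrix N"
    using B B' by (auto simp: is_standard_basis_def)
  have "M \<noteq> 0" using B M cmat.dependent_zero by (auto simp: is_standard_basis_def)
  then obtain x y where "M $ x $ y \<noteq> 0" by (auto simp: vec_eq_iff)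
  then have xy: "M $ x $ y = 1" using zo[of M] M by (auto simp: zero_one_matrix_iff)
  obtain N where N: "N \<in> B'" "N $ x $ y = 1" using standard_basis_cell[OF B'] by blast
  have W: "M \<in> W" "N \<in> W"
    using M N B B' cmat.span_base by (auto simp: is_standard_basis_def)
  have *: "M $ u $ v = 1 \<longleftrightarrow> N $ u $ v = 1" for u v
    using standard_basis_constant[OF B W(2) M, of x y u v]
      standard_basis_constant[OF B' W(1) N(1), of x y u v] xy N by auto
  have "M = N"
  proof -
    have "M $ u $ v = 0 \<or> M $ u $ v = 1" "N $ u $ v = 0 \<or> N $ u $ v = 1" for u v
      using zo[of M] zo[of N] M N by (simp_all add: zero_one_matrix_iff)
    with * show ?thesis unfolding vec_eq_iff by metis
  qed
  then show "M \<in> B'" using N by simp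
qed

lemma standard_basis_exists:
  fixes W :: "(complex^'v^'v::finite) set"
  assumes W: "coherent_algebra W"
  shows "\<exists>B. is_standard_basis W B"
proof -
  define R where "R = (\<lambda>p q. \<forall>M\<in>W. M $ fst p $ snd p = M $ fst q $ snd q)"
  define ind :: "'v \<times> 'v \<Rightarrow> complex^'v^'v" where
    "ind p = (\<chi> x y. if R p (x, y) then 1 else 0)" for p
  have sub: "cmat.subspace W" and J: "all_ones \<in> W"
    and ew: "\<And>M N. M \<in> W \<Longrightarrow> N \<in> W \<Longrightarrow> entrywise_mult M N \<in> W"
    using W by (auto simp: coherent_algebra_def)
  have R: "R p p" "R p q \<Longrightarrow> R q p" "R p q \<Longrightarrow> R q r \<Longrightarrow> R p r" for p q r
    by (auto simp: R_def)
  have sep: "\<exists>M\<in>W. M $ fst p $ snd p = 1 \<and> M $ fst q $ snd q = 0" if pq: "\<not> R p q" for p q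
  proof -
    obtain M where M: "M \<in> W" "M $ fst p $ snd p \<noteq> M $ fst q $ snd q"
      using pq by (auto simp: R_def)
    define N where "N = scale_matrix (1 / (M $ fst p $ snd p - M $ fst q $ snd q))
      (M - scale_matrix (M $ fst q $ snd q) all_ones)"
    have "N \<in> W" unfolding N_def
      by (intro cmat.subspace_scale[OF sub] cmat.subspace_diff[OF sub] M J)
    moreover have "N $ fst p $ snd p = 1 \<and> N $ fst q $ snd q = 0"
      using M(2) by (simp add: N_def scale_matrix_def all_ones_def)
    ultimately show ?thesis by blast
  qed
  have ind_W: "ind p \<in> W" for p
  proof -
    have "\<exists>M\<in>W. M $ fst p $ snd p = 1 \<and> (\<forall>q\<in>Q. M $ fst q $ snd q = 0)"
      if "finite Q" "\<And>q. q \<in> Q \<Longrightarrow> \<not> R p q" for Q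
      using that
    proof (induction Q)
      case empty
      show ?case by (rule bexI[OF _ J]) (simp add: all_ones_def)
    next
      case (insert a Q)
      obtain M where M: "M \<in> W" "M $ fst p $ snd p = 1" "\<forall>q\<in>Q. M $ fst q $ snd q = 0"
        using insert by auto
      obtain N where N: "N \<in> W" "N $ fst p $ snd p = 1" "N $ fst a $ snd a = 0"
        using sep[of p a] insert by auto
      show ?case
        by (rule bexI[OF _ ew[OF M(1) N(1)]]) (use M N in \<open>auto simp: entrywise_mult_def\<close>)
    qed
    from this[of "{q. \<not> R p q}", OF finite]
    have "\<exists>M\<in>W. M $ fst p $ snd p = 1 \<and> (\<forall>q\<in>{q. \<not> R p q}. M $ fst q $ snd q = 0)"
      by simp
    then obtain M where M: "M \<in> W" "M $ fst p $ snd p = 1"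
      "\<forall>q. \<not> R p q \<longrightarrow> M $ fst q $ snd q = 0"
      by blast
    have "M $ x $ y = ind p $ x $ y" for x y
    proof (cases "R p (x, y)")
      case True
      then have "M $ fst p $ snd p = M $ x $ y" using M(1) by (auto simp: R_def)
      then show ?thesis using True M(2) by (simp add: ind_def)
    next
      case False
      then show ?thesis using M(3)[rule_format, OF False] by (simp add: ind_def)
    qed
    then have "M = ind p" by (simp add: vec_eq_iff)
    then show ?thesis using M by simp
  qed
  define B where "B = range ind"
  have finB: "finite B" by (simp add: B_def)
  have ind_eq: "b = ind p" if "b \<in> B" "b $ fst p $ snd p \<noteq> 0" for b p
  proof -
    obtain q where q: "b = ind q" using \<open>b \<in> B\<close> by (auto simp: B_def)
    then have "R q p" using that by (auto simp: ind_def split: if_splits)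
    then have "R q r = R p r" for r using R by blast
    then show ?thesis by (simp add: q ind_def)
  qed
  have ind_self: "ind p $ fst p $ snd p = 1" for p using R(1) by (simp add: ind_def)
  have pick: "(\<Sum>b\<in>B. f b * b $ fst p $ snd p) = f (ind p)" for f p
  proof -
    have "(\<Sum>b\<in>B. f b * b $ fst p $ snd p) = (\<Sum>b\<in>{ind p}. f b * b $ fst p $ snd p)"
      by (rule sum.mono_neutral_right) (use finB ind_eq[of _ p] in \<open>auto simp: B_def\<close>)
    then show ?thesis by (simp add: ind_self)
  qed
  have comp: "(\<Sum>b\<in>B. scale_matrix (f b) b) $ x $ y = f (ind (x, y))" for f x y
    using pick[of f "(x, y)"] by (simp add: scale_matrix_def)
  have "cmat.independent B"
  proof -
    have "f b = 0" if zero: "(\<Sum>b\<in>B. scale_matrix (f b) b) = 0" and "b \<in> B" for f b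
    proof -
      obtain p where b: "b = ind p" using \<open>b \<in> B\<close> by (auto simp: B_def)
      show ?thesis using comp[of f "fst p" "snd p"] zero by (simp add: b)
    qed
    then show ?thesis unfolding cmat.dependent_finite[OF finB] by blast
  qed
  moreover have "cmat.span B = W"
  proof
    show "cmat.span B \<subseteq> W"
      by (rule cmat.span_minimal[OF _ sub]) (auto simp: B_def ind_W)
    show "W \<subseteq> cmat.span B"
    proof
      fix M assume M: "M \<in> W"
      define f where "f b = M $ fst (SOME p. b = ind p) $ snd (SOME p. b = ind p)" for b
      have "f (ind (x, y)) = M $ x $ y" for x y
      proof -
        define p where "p = (SOME p. ind (x, y) = ind p)"
        have "ind (x, y) = ind p" unfolding p_def by (rule someI[of _ "(x, y)"]) simp
        then have "ind (x, y) $ fst p $ snd p = 1" using ind_self by simp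
        then have "R (x, y) p" by (auto simp: ind_def split: if_splits)
        then show ?thesis using M by (simp add: f_def p_def[symmetric] R_def)
      qed
      then have "M = (\<Sum>b\<in>B. scale_matrix (f b) b)"
        using comp[of f] by (simp add: vec_eq_iff)
      moreover have "(\<Sum>b\<in>B. scale_matrix (f b) b) \<in> cmat.span B"
        by (intro cmat.span_sum cmat.span_scale cmat.span_base)
      ultimately show "M \<in> cmat.span B" by simp
    qed
  qed
  moreover have "\<forall>M\<in>B. zero_one_matrix M"
    by (auto simp: B_def zero_one_matrix_def ind_def)
  moreover have "\<Sum>B = all_ones"
    using comp[of "\<lambda>_. 1"] by (simp add: vec_eq_iff all_ones_def)
  ultimately show ?thesis unfolding is_standard_basis_def by blast
qed

theorem is_standard_basis_standard_basis:
  assumes "coherent_algebra W"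
  shows "is_standard_basis W (standard_basis W)"
  unfolding standard_basis_def
proof (rule theI')
  obtain B where B: "is_standard_basis W B" using standard_basis_exists[OF assms] by blast
  have "B' = B" if "is_standard_basis W B'" for B'
    using standard_basis_subset[OF B that] standard_basis_subset[OF that B] by simp
  with B show "\<exists>!B. is_standard_basis W B" by (rule ex1I)
qed

end

theory Submission
  imports Defs
begin

text \<open>
  Let \<open>W\<close> be the coherent closure, with fibres \<open>X\<^sub>1, \<dots>, X\<^sub>f\<close> and type matrix \<open>t\<close>. The nine basis
  matrices are distributed over \<open>f\<^sup>2\<close> nonempty blocks, so \<open>f \<le> 3\<close>.

  Most cases are excluded by one bound (\<open>coherent_rank_le_8\<close>). Suppose that the vertices are divided
  into at most two classes such that adjacency between vertices of different classes is constant and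
  each class induces a regular graph. Then the adjacency matrix \<open>A\<close> has a positive eigenvector \<open>\<alpha>\<close>
  that is constant on the classes (\<open>equitable_positive_eigenvector\<close>). Its eigenvalue is simple
  because the graph is connected. If \<open>a\<close> and \<open>b\<close> are the other two eigenvalues, then
  \<open>(A - a I)(A - b I)\<close> is a multiple of \<open>\<alpha> \<alpha>\<^sup>T\<close> and hence constant on each block, so the number of
  common neighbours of two vertices depends only on their classes, on whether they are equal and on
  whether they are adjacent (\<open>three_eigenvalue_common_neighbours\<close>). The matrices whose entries depend
  only on these data therefore form a coherent algebra containing \<open>A\<close>. It has rank at most eight,
  namely at most three for each diagonal block and one for each of the two others.

  The bound applies for \<open>f = 1\<close> (a single class) and for \<open>f = 2\<close>, \<open>t\<^sub>1\<^sub>2 = 1\<close> (the classes are the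
  fibres). For \<open>f = 3\<close> all blocks have a single basis matrix, so that the fibres are singletons and
  the graph has three vertices; one of them is adjacent to the two others, and the bound applies
  again. There remains \<open>f = 2\<close>, \<open>t\<^sub>1\<^sub>2 \<ge> 2\<close>. Then neither fibre is a singleton
  (\<open>block_count_singleton\<close>), so \<open>t\<^sub>1\<^sub>1, t\<^sub>2\<^sub>2 \<ge> 2\<close>, and \<open>t\<^sub>1\<^sub>1 + 2 t\<^sub>1\<^sub>2 + t\<^sub>2\<^sub>2 = 9\<close> leaves only \<open>t\<^sub>1\<^sub>2 = 2\<close>
  and \<open>{t\<^sub>1\<^sub>1, t\<^sub>2\<^sub>2} = {2, 3}\<close>.
\<close>

section \<open>Eigenvectors of symmetric real matrices\<close>

lemma symmetric_matrix_inner: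
  fixes A :: "real^'v^'v::finite"
  assumes "transpose A = A"
  shows "(A *v u) \<bullet> v = u \<bullet> (A *v v)"
  using dot_lmul_matrix[of u A v] assms by (metis transpose_matrix_vector)

text \<open>The eigenvector is a maximiser of the Rayleigh quotient on the subspace.\<close>

lemma invariant_subspace_eigenvector:
  fixes A :: "real^'v^'v::finite"
  assumes sym: "transpose A = A" and S: "subspace S"
    and inv: "\<And>x. x \<in> S \<Longrightarrow> A *v x \<in> S" and "w \<in> S" "w \<noteq> 0"
  shows "\<exists>c. \<exists>v\<in>S. v \<noteq> 0 \<and> A *v v = c *\<^sub>R v"
proof -
  define q where "q x = x \<bullet> (A *v x)" for x
  let ?K = "S \<inter> sphere 0 1"
  have "compact ?K"
    using closed_Int_compact[OF closed_subspace[OF S] compact_sphere] by blast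
  moreover have "(1 / norm w) *\<^sub>R w \<in> ?K"
    using assms by (simp add: subspace_scale)
  then have "?K \<noteq> {}" by blast
  moreover have "continuous_on ?K q"
    unfolding q_def by (intro continuous_intros)
  ultimately obtain v where v: "v \<in> ?K" and max: "\<And>y. y \<in> ?K \<Longrightarrow> q y \<le> q v"
    using continuous_attains_sup[of ?K q] by blast
  have vS: "v \<in> S" and vn: "v \<bullet> v = 1"
    using v by (auto simp: dot_square_norm)
  have le: "q y \<le> q v * (y \<bullet> y)" if "y \<in> S" for y
  proof (cases "y = 0")
    case False
    have "q ((1 / norm y) *\<^sub>R y) \<le> q v"
      by (rule max) (use that False S in \<open>simp add: subspace_scale\<close>)
    moreover have "q ((1 / norm y) *\<^sub>R y) = q y / (y \<bullet> y)"
      by (simp add: q_def matrix_vector_mult_scaleR dot_square_norm power2_eq_square)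
    ultimately show ?thesis using False by (simp add: divide_le_eq)
  qed (simp add: q_def)
  have orth: "u \<bullet> (A *v v) = 0" if u: "u \<in> S" "u \<bullet> v = 0" for u
  proof -
    let ?b = "u \<bullet> (A *v v)" and ?C = "q v * (u \<bullet> u) - q u"
    have *: "2 * t * ?b \<le> t^2 * ?C" for t
    proof -
      have i1: "q (v + t *\<^sub>R u) \<le> q v * ((v + t *\<^sub>R u) \<bullet> (v + t *\<^sub>R u))"
        by (rule le) (use u vS S in \<open>simp add: subspace_add subspace_scale\<close>)
      have i2: "(v + t *\<^sub>R u) \<bullet> (v + t *\<^sub>R u) = 1 + t^2 * (u \<bullet> u)"
        using u vn by (simp add: inner_add_left inner_add_right inner_commute power2_eq_square)
      have "v \<bullet> (A *v u) = ?b"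
        using symmetric_matrix_inner[OF sym, of v u] by (simp add: inner_commute)
      then have i3: "q (v + t *\<^sub>R u) = q v + 2 * t * ?b + t^2 * q u"
        by (simp add: q_def matrix_vector_right_distrib matrix_vector_mult_scaleR
            inner_add_left inner_add_right power2_eq_square algebra_simps)
      show ?thesis using i1 unfolding i2 i3 by (simp add: algebra_simps)
    qed
    show ?thesis
    proof (rule ccontr)
      assume b: "?b \<noteq> 0"
      \<comment> \<open>A parameter so small that the linear term dominates the quadratic one.\<close>
      define t where "t = ?b / (\<bar>?C\<bar> + 1)"
      have "?b = t * (\<bar>?C\<bar> + 1)" by (simp add: t_def)
      then have "2 * t^2 * (\<bar>?C\<bar> + 1) \<le> t^2 * ?C"
        using *[of t] by (simp add: power2_eq_square mult.assoc)
      moreover have "t^2 > 0" using b by (simp add: t_def)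
      ultimately have "2 * (\<bar>?C\<bar> + 1) \<le> ?C"
        by (metis (no_types, lifting) mult.assoc mult.left_commute mult_le_cancel_left_pos)
      moreover have "\<not> 2 * (\<bar>c\<bar> + 1) \<le> c" for c :: real
        by (cases "c \<ge> 0") auto
      ultimately show False by blast
    qed
  qed
  define r where "r = A *v v - q v *\<^sub>R v"
  have rS: "r \<in> S" unfolding r_def by (intro subspace_diff subspace_scale S inv vS)
  have rv: "r \<bullet> v = 0" using vn by (simp add: r_def q_def inner_diff_left) (simp add: inner_commute)
  have "r \<bullet> r = r \<bullet> (A *v v) - q v * (r \<bullet> v)"
    by (subst (2) r_def) (simp add: inner_diff_right)
  then have "r \<bullet> r = 0" using orth[OF rS rv] rv by simp
  then have "A *v v = q v *\<^sub>R v" by (simp add: r_def)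
  moreover have "v \<noteq> 0" using vn by auto
  ultimately show ?thesis using vS by blast
qed

text \<open>The minimal polynomial of a symmetric matrix has simple roots. The image of the product below
  is an invariant subspace; if it were nonzero, it would contain an eigenvector, whose eigenvalue
  is one of \<open>a\<close>, \<open>b\<close>, \<open>d\<close>.\<close>

lemma symmetric_matrix_cubic:
  fixes A :: "real^'v^'v::finite"
  assumes sym: "transpose A = A"
    and ev: "\<And>c v. v \<noteq> 0 \<Longrightarrow> A *v v = c *\<^sub>R v \<Longrightarrow> c \<in> {a, b, d}"
  shows "(A - a *\<^sub>R mat 1) *v ((A - b *\<^sub>R mat 1) *v ((A - d *\<^sub>R mat 1) *v x)) = 0"
proof (rule ccontr)
  define T where "T c x = A *v x - c *\<^sub>R x" for c x
  have T: "(A - c *\<^sub>R mat 1) *v x = T c x" for c x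
    by (simp add: T_def matrix_vector_mult_diff_rdistrib scaleR_matrix_vector_assoc[symmetric])
  assume "\<not> ?thesis"
  then have nz: "T a (T b (T d x)) \<noteq> 0" by (simp add: T)
  have linT: "linear (T c)" for c
    unfolding T_def by (intro linear_compose_sub linear_scale_self matrix_vector_mul_linear)
  have comm: "T c (T e y) = T e (T c y)" for c e y
    by (simp add: T_def matrix_vector_mult_diff_distrib matrix_vector_mult_scaleR algebra_simps)
  have commA: "A *v T c y = T c (A *v y)" for c y
    by (simp add: T_def matrix_vector_mult_diff_distrib matrix_vector_mult_scaleR)
  let ?S = "range (\<lambda>y. T a (T b (T d y)))"
  have "linear (\<lambda>y. T a (T b (T d y)))"
    using linear_compose[OF linear_compose[OF linT[of d] linT[of b]] linT[of a]] by (simp add: o_def)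
  then have "subspace ?S" by (rule linear_subspace_image[OF _ subspace_UNIV])
  moreover have "A *v y \<in> ?S" if "y \<in> ?S" for y
    using that commA by fastforce
  ultimately obtain c v where v: "v \<in> ?S" "v \<noteq> 0" "A *v v = c *\<^sub>R v"
    using invariant_subspace_eigenvector[OF sym, of ?S "T a (T b (T d x))"] nz by blast
  \<comment> \<open>The vector lies both in the kernel and in the image of the symmetric operator \<open>T c\<close>.\<close>
  have "\<exists>z. v = T c z"
    using ev[OF v(2,3)] v(1) comm by (smt (verit, best) empty_iff imageE insert_iff)
  then obtain z where z: "v = T c z" ..
  have "v \<bullet> v = v \<bullet> T c z" by (simp flip: z)
  also have "\<dots> = T c v \<bullet> z"
    using symmetric_matrix_inner[OF sym, of v z]
    by (simp add: T_def inner_diff_left inner_diff_right)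
  also have "\<dots> = 0" by (simp add: T_def v(3))
  finally show False using v(2) by simp
qed

section \<open>Graphs with three eigenvalues and a positive eigenvector\<close>

text \<open>The adjacency matrix over the reals, where the spectral argument takes place.\<close>

definition real_adjacency :: "('v::finite \<Rightarrow> 'v \<Rightarrow> bool) \<Rightarrow> real^'v^'v" where
  "real_adjacency E = (\<chi> x y. if E x y then 1 else 0)"

lemma real_adjacency_mult:
  "(real_adjacency E *v v) $ x = (\<Sum>y | E x y. v $ y)"
  by (simp add: real_adjacency_def matrix_vector_mult_def if_distrib[of "\<lambda>t. t * _"]
      sum.If_cases cong: if_cong)

lemma transpose_real_adjacency:
  "simple_graph E \<Longrightarrow> transpose (real_adjacency E) = real_adjacency E"
  by (auto simp: real_adjacency_def transpose_def vec_eq_iff simple_graph_def dest: sympD)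

lemma real_eigenvalue:
  assumes "v \<noteq> 0" "real_adjacency E *v v = c *\<^sub>R v"
  shows "complex_of_real c \<in> eigenvalues (adjacency_matrix E)"
proof -
  let ?w = "(\<chi> x. complex_of_real (v $ x)) :: complex^'a"
  have "(adjacency_matrix E *v ?w) $ x = (c' *s ?w) $ x"
    if "c' = complex_of_real c" for x c'
  proof -
    have "(adjacency_matrix E *v ?w) $ x = of_real ((real_adjacency E *v v) $ x)"
      by (simp add: adjacency_matrix_def real_adjacency_def matrix_vector_mult_def
          if_distrib[of "\<lambda>t. t * _"] if_distrib[of complex_of_real] cong: if_cong)
    also have "\<dots> = c' * of_real (v $ x)"
      by (subst assms(2)) (simp add: that)
    finally show ?thesis by simp
  qed
  then have "adjacency_matrix E *v ?w = complex_of_real c *s ?w" by (simp add: vec_eq_iff)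
  moreover have "?w \<noteq> 0" using assms(1) by (simp add: vec_eq_iff)
  ultimately show ?thesis unfolding eigenvalues_def by blast
qed

text \<open>Subtracting the right multiple of the positive eigenvector leaves a nonnegative vector of
  the same eigenspace with a zero entry, and zeros of such a vector spread along edges.\<close>

lemma positive_eigenvector_simple:
  assumes conn: "connected_graph E"
    and pos: "\<And>x. \<alpha> $ x > 0" and \<alpha>: "real_adjacency E *v \<alpha> = r *\<^sub>R \<alpha>"
    and v: "real_adjacency E *v v = r *\<^sub>R v"
  shows "\<exists>t. v = t *\<^sub>R \<alpha>"
proof -
  define t where "t = Min (range (\<lambda>x. v $ x / \<alpha> $ x))"
  define u where "u = v - t *\<^sub>R \<alpha>"
  have "t \<in> range (\<lambda>x. v $ x / \<alpha> $ x)" unfolding t_def by (rule Min_in) auto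
  then obtain x0 where "t = v $ x0 / \<alpha> $ x0" by blast
  then have u0: "u $ x0 = 0" using pos[of x0] by (simp add: u_def)
  have un: "u $ x \<ge> 0" for x
  proof -
    have "t \<le> v $ x / \<alpha> $ x" unfolding t_def by (rule Min_le) auto
    then show ?thesis using pos[of x] by (simp add: u_def pos_le_divide_eq)
  qed
  have Au: "real_adjacency E *v u = r *\<^sub>R u"
    by (simp add: u_def matrix_vector_mult_diff_distrib matrix_vector_mult_scaleR \<alpha> v algebra_simps)
  have step: "u $ y = 0" if "u $ x = 0" "E x y" for x y
  proof -
    have "(\<Sum>z | E x z. u $ z) = 0"
      using arg_cong[OF Au, of "\<lambda>w. w $ x"] that(1) by (simp add: real_adjacency_mult)
    then show ?thesis using that(2) un by (subst (asm) sum_nonneg_eq_0_iff) auto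
  qed
  have "u $ y = 0" for y
  proof -
    have "E\<^sup>*\<^sup>* x0 y" using conn by (simp add: connected_graph_def)
    then show ?thesis by induction (use u0 step in auto)
  qed
  then have "v = t *\<^sub>R \<alpha>" by (simp add: u_def vec_eq_iff)
  then show ?thesis ..
qed

lemma real_adjacency_square:
  "(real_adjacency E ** real_adjacency E) $ x $ y = real (card {z. E x z \<and> E z y})"
proof -
  have "(real_adjacency E ** real_adjacency E) $ x $ y = (\<Sum>z\<in>UNIV. if E x z \<and> E z y then 1 else 0)"
    by (auto simp: matrix_matrix_mult_def real_adjacency_def intro!: sum.cong)
  then show ?thesis by (simp add: sum.If_cases)
qed

text \<open>If \<open>r\<close>, \<open>a\<close>, \<open>b\<close> are the eigenvalues and \<open>r\<close> belongs to the positive eigenvector \<open>\<alpha>\<close>, then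
  every column of \<open>(A - a I)(A - b I)\<close> lies in the eigenspace of \<open>r\<close>, so this symmetric matrix is a
  multiple of \<open>\<alpha> \<alpha>\<^sup>T\<close>.\<close>

lemma three_eigenvalue_common_neighbours:
  fixes E :: "'v::finite \<Rightarrow> 'v \<Rightarrow> bool"
  assumes G: "three_eigenvalue_graph E"
    and pos: "\<And>x. \<alpha> $ x > 0" and \<alpha>: "real_adjacency E *v \<alpha> = r *\<^sub>R \<alpha>"
  shows "\<exists>s p k. \<forall>x y. real (card {z. E x z \<and> E z y})
    = s * of_bool (E x y) + p * of_bool (x = y) + k * (\<alpha> $ x * \<alpha> $ y)"
proof -
  let ?A = "real_adjacency E" and ?ev = "eigenvalues (adjacency_matrix E)"
  have conn: "connected_graph E" and card3: "card ?ev = 3"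
    using G by (auto simp: three_eigenvalue_graph_def)
  have sg: "simple_graph E" using conn by (simp add: connected_graph_def)
  note sym = transpose_real_adjacency[OF sg]
  have "\<alpha> \<noteq> 0" using pos by (metis less_irrefl zero_index)
  then have r: "complex_of_real r \<in> ?ev" using real_eigenvalue \<alpha> by blast
  then have "card (?ev - {of_real r}) = 2" using card3 by (simp add: card_Diff_singleton)
  then obtain a' b' where ab: "?ev - {of_real r} = {a', b'}" by (meson card_2_iff)
  define a b where "a = Re a'" and "b = Re b'"
  have "c \<in> {r, a, b}" if "v \<noteq> 0" "?A *v v = c *\<^sub>R v" for c v
  proof -
    have "complex_of_real c \<in> insert (of_real r) (?ev - {of_real r})"
      using real_eigenvalue[OF that] r by auto
    then have "complex_of_real c \<in> {of_real r, a', b'}" by (simp add: ab)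
    then show ?thesis by (auto simp: a_def b_def)
  qed
  then have cubic: "(?A - r *\<^sub>R mat 1) *v ((?A - a *\<^sub>R mat 1) *v ((?A - b *\<^sub>R mat 1) *v x)) = 0" for x
    using symmetric_matrix_cubic[OF sym] by blast
  define M where "M = (?A - a *\<^sub>R mat 1) ** (?A - b *\<^sub>R mat 1)"
  have M: "M $ x $ y = real (card {z. E x z \<and> E z y}) - (a + b) * of_bool (E x y)
      + a * b * of_bool (x = y)" for x y
  proof -
    have "M *v w = (?A ** ?A - (a + b) *\<^sub>R ?A + (a * b) *\<^sub>R mat 1) *v w" for w
      by (simp add: M_def matrix_vector_mult_diff_rdistrib matrix_vector_mult_add_rdistrib
          matrix_vector_mult_diff_distrib matrix_vector_mult_scaleR algebra_simps
          flip: matrix_vector_mul_assoc scaleR_matrix_vector_assoc)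
    then have "M = ?A ** ?A - (a + b) *\<^sub>R ?A + (a * b) *\<^sub>R mat 1"
      by (simp add: matrix_eq)
    then have "M $ x $ y = (?A ** ?A) $ x $ y - (a + b) * ?A $ x $ y + a * b * mat 1 $ x $ y"
      by simp
    then show ?thesis
      unfolding real_adjacency_square by (simp add: real_adjacency_def mat_def)
  qed
  have Msym: "M $ x $ y = M $ y $ x" for x y
  proof -
    have E: "E u v \<longleftrightarrow> E v u" for u v using sg by (auto simp: simple_graph_def dest: sympD)
    then have "{z. E x z \<and> E z y} = {z. E y z \<and> E z x}" by blast
    then show ?thesis using E[of x y] by (simp add: M eq_commute[of x y])
  qed
  have "\<exists>t. column y M = t *\<^sub>R \<alpha>" for y
  proof -
    have "(?A - r *\<^sub>R mat 1) *v (M *v axis y 1) = 0"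
      unfolding M_def by (simp add: cubic flip: matrix_vector_mul_assoc)
    then have "?A *v (M *v axis y 1) = r *\<^sub>R (M *v axis y 1)"
      by (simp add: matrix_vector_mult_diff_rdistrib scaleR_matrix_vector_assoc[symmetric])
    from positive_eigenvector_simple[OF conn pos \<alpha> this]
    show ?thesis by (simp add: matrix_vector_mult_basis)
  qed
  then obtain t where t: "\<And>y. column y M = t y *\<^sub>R \<alpha>" by metis
  have Mt: "M $ x $ y = t y * \<alpha> $ x" for x y
    using arg_cong[OF t[of y], of "\<lambda>w. w $ x"] by (simp add: column_def)
  obtain o' :: 'v where True by blast
  define k where "k = t o' / \<alpha> $ o'"
  have "M $ x $ y = k * (\<alpha> $ x * \<alpha> $ y)" for x y
  proof -
    have "t y * \<alpha> $ o' = t o' * \<alpha> $ y" using Msym[of o' y] by (simp add: Mt)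
    then have "t y = k * \<alpha> $ y" using pos[of o'] by (simp add: k_def field_simps)
    then show ?thesis by (simp add: Mt)
  qed
  then have "real (card {z. E x z \<and> E z y})
    = (a + b) * of_bool (E x y) + (- a * b) * of_bool (x = y) + k * (\<alpha> $ x * \<alpha> $ y)" for x y
    using M[of x y] by (simp add: algebra_simps)
  then show ?thesis by blast
qed


section \<open>Two-class partitions with constant adjacency across the classes\<close>

text \<open>If both classes are nonempty, then all vertices of one class are adjacent to all vertices of
  the other, and the eigenvector comes from the larger root of the characteristic polynomial of the
  quotient matrix.\<close>

lemma equitable_positive_eigenvector:
  fixes E :: "'v::finite \<Rightarrow> 'v \<Rightarrow> bool" and P :: "'v \<Rightarrow> bool"
  assumes conn: "connected_graph E"
    and cross: "\<And>x y. P x \<noteq> P y \<Longrightarrow> E x y = \<beta>"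
    and deg: "\<And>x y. P x = P y \<Longrightarrow>
      card {z. P z = P x \<and> E x z} = card {z. P z = P y \<and> E y z}"
  shows "\<exists>r \<alpha>. (\<forall>x. \<alpha> $ x > 0) \<and> real_adjacency E *v \<alpha> = r *\<^sub>R \<alpha>
    \<and> (\<forall>x y. P x = P y \<longrightarrow> \<alpha> $ x = \<alpha> $ y)"
proof (cases "\<exists>p. \<forall>x. P x = p")
  case True
  then have P: "P x = P y" for x y by metis
  obtain o' :: 'v where True by blast
  have "card {z. E x z} = card {z. E o' z}" for x using deg[OF P, of x o'] P by simp
  then have "real_adjacency E *v (\<chi> x. 1) = real (card {z. E o' z}) *\<^sub>R (\<chi> x. 1)"
    by (simp add: vec_eq_iff real_adjacency_mult)
  then show ?thesis by (intro exI[of _ "real (card {z. E o' z})"] exI[of _ "\<chi> x. 1"]) simp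
next
  case False
  then obtain a b where a: "P a" and b: "\<not> P b" by metis
  have \<beta>
  proof (rule ccontr)
    assume "\<not> \<beta>"
    moreover have "E\<^sup>*\<^sup>* a b" using conn by (simp add: connected_graph_def)
    then have "P b" by induction (use a cross \<open>\<not> \<beta>\<close> in auto)
    ultimately show False using b by simp
  qed
  define n m k l where "n = real (card {z. P z})" and "m = real (card {z. \<not> P z})"
    and "k = real (card {z. P z \<and> E a z})" and "l = real (card {z. \<not> P z \<and> E b z})"
  have nm: "n > 0" "m > 0" using a b by (auto simp: n_def m_def card_gt_0_iff)
  define r where "r = (k + l + sqrt ((k - l)^2 + 4 * n * m)) / 2"
  have "sqrt ((k - l)^2 + 4 * n * m) > sqrt ((k - l)^2)"
    using nm by (intro real_sqrt_less_mono) simp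
  then have "r > k" by (simp add: r_def)
  have "2 * r - k - l = sqrt ((k - l)^2 + 4 * n * m)" by (simp add: r_def field_simps)
  then have "(2 * r - k - l)^2 = (k - l)^2 + 4 * n * m" using nm by simp
  then have r: "(r - k) * (r - l) = n * m" by (simp add: power2_eq_square algebra_simps)
  define \<alpha> :: "real^'v" where "\<alpha> = (\<chi> x. if P x then m else r - k)"
  have Aa: "(real_adjacency E *v \<alpha>) $ x =
    real (card {z. P z = P x \<and> E x z}) * (if P x then m else r - k)
    + real (card {z. P z \<noteq> P x}) * (if P x then r - k else m)" for x
  proof -
    have "{y. E x y} = {z. P z = P x \<and> E x z} \<union> {z. P z \<noteq> P x}"
      using cross[of x] \<open>\<beta>\<close> by blast
    then have "(real_adjacency E *v \<alpha>) $ x =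
      (\<Sum>y | P y = P x \<and> E x y. \<alpha> $ y) + (\<Sum>y | P y \<noteq> P x. \<alpha> $ y)"
      unfolding real_adjacency_mult by (simp, subst sum.union_disjoint) auto
    also have "(\<Sum>y | P y = P x \<and> E x y. \<alpha> $ y) =
      (\<Sum>y | P y = P x \<and> E x y. if P x then m else r - k)"
      by (rule sum.cong) (auto simp: \<alpha>_def)
    also have "(\<Sum>y | P y \<noteq> P x. \<alpha> $ y) = (\<Sum>y | P y \<noteq> P x. if P x then r - k else m)"
      by (rule sum.cong) (auto simp: \<alpha>_def)
    finally show ?thesis by simp
  qed
  have "(real_adjacency E *v \<alpha>) $ x = r * \<alpha> $ x" for x
  proof (cases "P x")
    case True
    then show ?thesis using deg[of x a] a
      by (simp add: Aa) (simp add: \<alpha>_def k_def m_def algebra_simps)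
  next
    case False
    then have "(real_adjacency E *v \<alpha>) $ x = l * (r - k) + n * m"
      using deg[of x b] b by (simp add: Aa) (simp add: l_def n_def)
    also have "\<dots> = r * (r - k)" unfolding r[symmetric] by (simp add: algebra_simps)
    finally show ?thesis using False by (simp add: \<alpha>_def)
  qed
  then have "real_adjacency E *v \<alpha> = r *\<^sub>R \<alpha>" by (simp add: vec_eq_iff)
  moreover have "\<forall>x. \<alpha> $ x > 0" using nm \<open>r > k\<close> by (simp add: \<alpha>_def)
  ultimately show ?thesis by (intro exI[of _ r] exI[of _ \<alpha>]) (simp add: \<alpha>_def)
qed

text \<open>The colour of a pair of vertices for a partition of the vertices into the class \<open>P\<close> and its
  complement: the two classes, equality, and adjacency. Adjacency is recorded only within a class,
  so that there are at most eight colours.\<close>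

definition pair_colour :: "('v::finite \<Rightarrow> 'v \<Rightarrow> bool) \<Rightarrow> ('v \<Rightarrow> bool) \<Rightarrow> 'v \<Rightarrow> 'v
    \<Rightarrow> bool \<times> bool \<times> bool \<times> bool" where
  "pair_colour E P x y = (P x, P y, x = y, P x = P y \<and> E x y)"

text \<open>The matrices that are constant on each colour.\<close>

definition colour_matrices ::
    "('v::finite \<Rightarrow> 'v \<Rightarrow> bool) \<Rightarrow> ('v \<Rightarrow> bool) \<Rightarrow> (complex^'v^'v) set" where
  "colour_matrices E P =
     {M. \<forall>x y u v. pair_colour E P x y = pair_colour E P u v \<longrightarrow> M $ x $ y = M $ u $ v}"

lemma colour_matricesI:
  "(\<And>x y u v. pair_colour E P x y = pair_colour E P u v \<Longrightarrow> M $ x $ y = M $ u $ v)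
    \<Longrightarrow> M \<in> colour_matrices E P"
  unfolding colour_matrices_def by blast

lemma colour_matricesD:
  "M \<in> colour_matrices E P \<Longrightarrow> pair_colour E P x y = pair_colour E P u v
    \<Longrightarrow> M $ x $ y = M $ u $ v"
  unfolding colour_matrices_def by blast

lemma colour_matrices_pointwise:
  assumes "M \<in> colour_matrices E P" "N \<in> colour_matrices E P"
  shows "(\<chi> x y. f (M $ x $ y) (N $ x $ y)) \<in> colour_matrices E P"
proof (rule colour_matricesI)
  fix x y u v assume p: "pair_colour E P x y = pair_colour E P u v"
  show "(\<chi> x y. f (M $ x $ y) (N $ x $ y)) $ x $ y = (\<chi> x y. f (M $ x $ y) (N $ x $ y)) $ u $ v"
    using colour_matricesD[OF assms(1) p] colour_matricesD[OF assms(2) p] by simp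
qed

text \<open>On the diagonal blocks the matrices of this space are combinations of the all-ones matrix, the
  identity and the adjacency matrix \<open>D\<close> within the classes; on the other blocks they are constant.
  Of the nine products that arise only \<open>D\<^sup>2\<close> needs the hypothesis on common neighbours.\<close>

lemma colour_matrices_mult:
  fixes E :: "'v::finite \<Rightarrow> 'v \<Rightarrow> bool" and P :: "'v \<Rightarrow> bool"
  assumes sg: "simple_graph E"
    and cross: "\<And>x y. P x \<noteq> P y \<Longrightarrow> E x y = \<beta>"
    and deg: "\<And>x y. P x = P y \<Longrightarrow>
      card {z. P z = P x \<and> E x z} = card {z. P z = P y \<and> E y z}"
    and common: "\<And>x y u v. pair_colour E P x y = pair_colour E P u v \<Longrightarrow>
      card {z. E x z \<and> E z y} = card {z. E u z \<and> E z v}"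
    and M: "M \<in> colour_matrices E P" and N: "N \<in> colour_matrices E P"
  shows "M ** N \<in> colour_matrices E P"
proof -
  define D where "D x y \<longleftrightarrow> P x = P y \<and> E x y" for x y
  have E: "E x y \<longleftrightarrow> E y x" "\<not> E x x" for x y
    using sg by (auto simp: simple_graph_def irreflp_def dest: sympD)
  then have D: "D x y \<longleftrightarrow> D y x" "\<not> D x x" "D x y \<Longrightarrow> P x = P y" for x y
    by (auto simp: D_def)
  \<comment> \<open>The constant coefficient of a block is the entry at distinct vertices that are not \<open>D\<close>-adjacent.
    If the block has no such pair, its value is arbitrary and cancels.\<close>
  have decomp: "\<exists>f g h. \<forall>x y. L $ x $ y = f (P x) (P y) + (if x = y then g (P x) else 0)
      + (if D x y then h (P x) else 0)" if L: "L \<in> colour_matrices E P" for L :: "complex^'v^'v"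
  proof -
    define p where "p t = (SOME q. pair_colour E P (fst q) (snd q) = t)" for t
    define F where "F t = L $ fst (p t) $ snd (p t)" for t
    have F: "L $ x $ y = F (P x, P y, x = y, D x y)" for x y
    proof -
      have "pair_colour E P (fst (p t)) (snd (p t)) = t" if "t = pair_colour E P x y" for t
        unfolding p_def by (rule someI[of _ "(x, y)"]) (simp add: that)
      from colour_matricesD[OF L this[OF refl]] have "F (pair_colour E P x y) = L $ x $ y"
        unfolding F_def .
      then show ?thesis by (simp add: pair_colour_def D_def)
    qed
    show ?thesis
      by (rule exI[of _ "\<lambda>i j. F (i, j, False, False)"],
          rule exI[of _ "\<lambda>i. F (i, i, True, False) - F (i, i, False, False)"],
          rule exI[of _ "\<lambda>i. F (i, i, False, True) - F (i, i, False, False)"])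
        (use F D in auto)
  qed
  obtain f g h where M': "\<And>x y. M $ x $ y = f (P x) (P y) + (if x = y then g (P x) else 0)
      + (if D x y then h (P x) else 0)"
    using decomp[OF M] by blast
  obtain f' g' h' where N': "\<And>x y. N $ x $ y = f' (P x) (P y) + (if x = y then g' (P x) else 0)
      + (if D x y then h' (P x) else 0)"
    using decomp[OF N] by blast
  define d where "d x = (of_nat (card {z. D x z}) :: complex)" for x
  define c where "c x y = (of_nat (card {z. D x z \<and> D z y}) :: complex)" for x y
  have MN: "(M ** N) $ x $ y = (\<Sum>z\<in>UNIV. f (P x) (P z) * f' (P z) (P y))
      + f (P x) (P y) * g' (P y) + d y * (f (P x) (P y) * h' (P y))
      + g (P x) * f' (P x) (P y) + (if x = y then g (P x) * g' (P y) else 0)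
      + (if D x y then g (P x) * h' (P x) else 0)
      + d x * (h (P x) * f' (P x) (P y)) + (if D x y then h (P x) * g' (P y) else 0)
      + c x y * (h (P x) * h' (P x))" for x y
  proof -
    have expand: "(a1 + a2 + a3) * (b1 + b2 + b3) = a1 * b1 + a1 * b2 + a1 * b3
        + a2 * b1 + a2 * b2 + a2 * b3 + a3 * b1 + a3 * b2 + a3 * b3"
      for a1 a2 a3 b1 b2 b3 :: complex
      by (simp add: algebra_simps)
    have fh: "(\<Sum>z\<in>UNIV. f (P x) (P z) * (if D z y then h' (P z) else 0))
        = d y * (f (P x) (P y) * h' (P y))"
    proof -
      have "(\<Sum>z\<in>UNIV. f (P x) (P z) * (if D z y then h' (P z) else 0))
        = (\<Sum>z\<in>UNIV. if D y z then f (P x) (P y) * h' (P y) else 0)"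
        using D by (intro sum.cong) auto
      then show ?thesis by (simp add: sum.If_cases d_def)
    qed
    have hf: "(\<Sum>z\<in>UNIV. (if D x z then h (P x) else 0) * f' (P z) (P y))
        = d x * (h (P x) * f' (P x) (P y))"
    proof -
      have "(\<Sum>z\<in>UNIV. (if D x z then h (P x) else 0) * f' (P z) (P y))
        = (\<Sum>z\<in>UNIV. if D x z then h (P x) * f' (P x) (P y) else 0)"
        using D by (intro sum.cong) auto
      then show ?thesis by (simp add: sum.If_cases d_def)
    qed
    have hh: "(\<Sum>z\<in>UNIV. (if D x z then h (P x) else 0) * (if D z y then h' (P z) else 0))
        = c x y * (h (P x) * h' (P x))"
    proof -
      have "(\<Sum>z\<in>UNIV. (if D x z then h (P x) else 0) * (if D z y then h' (P z) else 0))
        = (\<Sum>z\<in>UNIV. if D x z \<and> D z y then h (P x) * h' (P x) else 0)"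
        using D(3) by (intro sum.cong) auto
      then show ?thesis by (simp add: sum.If_cases c_def)
    qed
    have del: "(\<Sum>z\<in>UNIV. k z * (if z = y then k' z else 0)) = k y * k' y"
      "(\<Sum>z\<in>UNIV. (if x = z then w else 0) * k z) = w * k x" for k k' :: "'v \<Rightarrow> complex" and w
      by (simp_all add: if_distrib[of "\<lambda>t. _ * t"] if_distrib[of "\<lambda>t. t * _"] cong: if_cong)
    have "(M ** N) $ x $ y = (\<Sum>z\<in>UNIV. M $ x $ z * N $ z $ y)"
      by (simp add: matrix_matrix_mult_def)
    also have "\<dots> = (\<Sum>z\<in>UNIV. f (P x) (P z) * f' (P z) (P y))
      + (\<Sum>z\<in>UNIV. f (P x) (P z) * (if z = y then g' (P z) else 0))
      + (\<Sum>z\<in>UNIV. f (P x) (P z) * (if D z y then h' (P z) else 0))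
      + (\<Sum>z\<in>UNIV. (if x = z then g (P x) else 0) * f' (P z) (P y))
      + (\<Sum>z\<in>UNIV. (if x = z then g (P x) else 0) * (if z = y then g' (P z) else 0))
      + (\<Sum>z\<in>UNIV. (if x = z then g (P x) else 0) * (if D z y then h' (P z) else 0))
      + (\<Sum>z\<in>UNIV. (if D x z then h (P x) else 0) * f' (P z) (P y))
      + (\<Sum>z\<in>UNIV. (if D x z then h (P x) else 0) * (if z = y then g' (P z) else 0))
      + (\<Sum>z\<in>UNIV. (if D x z then h (P x) else 0) * (if D z y then h' (P z) else 0))"
      unfolding M' N' sum.distrib[symmetric] by (rule sum.cong[OF refl], rule expand)
    finally show ?thesis unfolding fh hf hh del by simp
  qed
  have d: "d x = d y" if "P x = P y" for x y
  proof -
    have "{z. D x z} = {z. P z = P x \<and> E x z}" for x by (auto simp: D_def)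
    then show ?thesis using deg[OF that] by (simp add: d_def)
  qed
  have c: "c x y = c u v" if p: "pair_colour E P x y = pair_colour E P u v" for x y u v
  proof (cases "P x = P y")
    case False
    then have "{z. D x z \<and> D z y} = {}" "{z. D u z \<and> D z v} = {}"
      using p D(3) by (auto simp: pair_colour_def)
    then show ?thesis by (simp only: c_def)
  next
    case True
    \<comment> \<open>The common neighbours outside the class are all or none of the vertices there.\<close>
    have *: "card {z. E x z \<and> E z y} = card {z. D x z \<and> D z y} + card {z. P z \<noteq> P x \<and> \<beta>}"
      if "P x = P y" for x y
    proof -
      have "{z. E x z \<and> E z y} = {z. D x z \<and> D z y} \<union> {z. P z \<noteq> P x \<and> \<beta>}"
      proof (rule set_eqI)
        fix z
        have "E x z = \<beta>" "E z y = \<beta>" if "P z \<noteq> P x"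
          using cross[of x z] cross[of z y] that \<open>P x = P y\<close> by auto
        then show "z \<in> {z. E x z \<and> E z y} \<longleftrightarrow>
            z \<in> {z. D x z \<and> D z y} \<union> {z. P z \<noteq> P x \<and> \<beta>}"
          using \<open>P x = P y\<close> by (cases "P z = P x") (simp_all add: D_def)
      qed
      moreover have "{z. D x z \<and> D z y} \<inter> {z. P z \<noteq> P x \<and> \<beta>} = {}"
        by (auto simp: D_def)
      ultimately show ?thesis by (simp add: card_Un_disjoint)
    qed
    have "P u = P v" "P x = P u" using p True by (auto simp: pair_colour_def)
    then show ?thesis using *[OF True] *[of u v] common[OF p] by (simp add: c_def)
  qed
  show ?thesis
  proof (rule colour_matricesI)
    fix x y u v assume p: "pair_colour E P x y = pair_colour E P u v"
    then have "P x = P u" "P y = P v" "(x = y) = (u = v)" "D x y = D u v"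
      by (auto simp: pair_colour_def D_def)
    then show "(M ** N) $ x $ y = (M ** N) $ u $ v"
      unfolding MN c[OF p] by (simp add: d[of x u] d[of y v])
  qed
qed

lemma coherent_algebra_colour_matrices:
  fixes E :: "'v::finite \<Rightarrow> 'v \<Rightarrow> bool" and P :: "'v \<Rightarrow> bool"
  assumes sg: "simple_graph E"
    and cross: "\<And>x y. P x \<noteq> P y \<Longrightarrow> E x y = \<beta>"
    and deg: "\<And>x y. P x = P y \<Longrightarrow>
      card {z. P z = P x \<and> E x z} = card {z. P z = P y \<and> E y z}"
    and common: "\<And>x y u v. pair_colour E P x y = pair_colour E P u v \<Longrightarrow>
      card {z. E x z \<and> E z y} = card {z. E u z \<and> E z v}"
  shows "coherent_algebra (colour_matrices E P)"
proof -
  have sym: "pair_colour E P y x = pair_colour E P v u"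
    if "pair_colour E P x y = pair_colour E P u v" for x y u v
    using that sg by (auto simp: pair_colour_def simple_graph_def dest: sympD)
  have "transpose M \<in> colour_matrices E P" if M: "M \<in> colour_matrices E P" for M
  proof (rule colour_matricesI)
    fix x y u v assume "pair_colour E P x y = pair_colour E P u v"
    from colour_matricesD[OF M sym[OF this]] show "transpose M $ x $ y = transpose M $ u $ v"
      by (simp add: transpose_def)
  qed
  moreover have "0 \<in> colour_matrices E P" by (simp add: colour_matricesI)
  moreover have "M + N \<in> colour_matrices E P" "entrywise_mult M N \<in> colour_matrices E P"
    "scale_matrix c M \<in> colour_matrices E P"
    if "M \<in> colour_matrices E P" "N \<in> colour_matrices E P" for M N c
    using colour_matrices_pointwise[OF that, of "(+)"]
      colour_matrices_pointwise[OF that, of "(*)"]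
      colour_matrices_pointwise[OF that, of "\<lambda>a b. c * a"]
    by (simp_all add: plus_vec_def entrywise_mult_def scale_matrix_def)
  moreover have "M ** N \<in> colour_matrices E P"
    if "M \<in> colour_matrices E P" "N \<in> colour_matrices E P" for M N
    by (rule colour_matrices_mult[OF sg cross deg common that])
  moreover have "mat 1 \<in> colour_matrices E P" "all_ones \<in> colour_matrices E P"
    by (rule colour_matricesI, auto simp: pair_colour_def mat_def all_ones_def)+
  ultimately show ?thesis
    unfolding coherent_algebra_def cmat.subspace_def by simp
qed

lemma card_pair_colours: "card (range (\<lambda>p. pair_colour E P (fst p) (snd p))) \<le> 8"
  if "simple_graph E"
proof -
  let ?C = "{(True, False, False, False), (False, True, False, False),
    (True, True, True, False), (True, True, False, True), (True, True, False, False),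
    (False, False, True, False), (False, False, False, True), (False, False, False, False)}"
  have "\<not> E x x" for x using that by (simp add: simple_graph_def irreflp_def)
  then have "pair_colour E P x y \<in> ?C" for x y
    by (cases "P x"; cases "P y"; cases "x = y"; cases "E x y") (simp_all add: pair_colour_def)
  then have "range (\<lambda>p. pair_colour E P (fst p) (snd p)) \<subseteq> ?C"
    unfolding image_subset_iff by blast
  then have "card (range (\<lambda>p. pair_colour E P (fst p) (snd p))) \<le> card ?C"
    by (intro card_mono) auto
  then show ?thesis by simp
qed

text \<open>Distinct basis matrices have disjoint supports, which are unions of colours.\<close>

lemma algebra_rank_le_colours:
  assumes W: "coherent_algebra W" and sub: "W \<subseteq> colour_matrices E P"
  shows "algebra_rank W \<le> card (range (\<lambda>p. pair_colour E P (fst p) (snd p)))"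
proof -
  let ?B = "standard_basis W" and ?col = "\<lambda>p. pair_colour E P (fst p) (snd p)"
  note B = is_standard_basis_standard_basis[OF W]
  have "\<exists>p. M $ fst p $ snd p = 1" if "M \<in> ?B" for M
  proof -
    have "M \<noteq> 0" using B that cmat.dependent_zero by (auto simp: is_standard_basis_def)
    then obtain x y where "M $ x $ y \<noteq> 0" by (auto simp: vec_eq_iff)
    moreover have "zero_one_matrix M" using B that by (auto simp: is_standard_basis_def)
    ultimately have "M $ x $ y = 1" by (auto simp: zero_one_matrix_iff)
    then show ?thesis by (intro exI[of _ "(x, y)"]) simp
  qed
  then obtain p where p: "\<And>M. M \<in> ?B \<Longrightarrow> M $ fst (p M) $ snd (p M) = 1" by metis
  have "inj_on (\<lambda>M. ?col (p M)) ?B"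
  proof
    fix M N assume *: "M \<in> ?B" "N \<in> ?B" "?col (p M) = ?col (p N)"
    have "M \<in> W" using B * cmat.span_base by (auto simp: is_standard_basis_def)
    then have "M $ fst (p N) $ snd (p N) = 1"
      using colour_matricesD[OF subsetD[OF sub] *(3)] p[OF *(1)] by simp
    then show "M = N" using standard_basis_cell_unique[OF B *(1,2)] p[OF *(2)] by blast
  qed
  then show ?thesis unfolding algebra_rank_def by (rule card_inj_on_le) auto
qed

lemma coherent_rank_le_8:
  fixes E :: "'v::finite \<Rightarrow> 'v \<Rightarrow> bool" and P :: "'v \<Rightarrow> bool"
  assumes G: "three_eigenvalue_graph E"
    and cross: "\<And>x y. P x \<noteq> P y \<Longrightarrow> E x y = \<beta>"
    and deg: "\<And>x y. P x = P y \<Longrightarrow>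
      card {z. P z = P x \<and> E x z} = card {z. P z = P y \<and> E y z}"
  shows "coherent_rank E \<le> 8"
proof -
  have conn: "connected_graph E" using G by (simp add: three_eigenvalue_graph_def)
  then have sg: "simple_graph E" by (simp add: connected_graph_def)
  obtain r \<alpha> where \<alpha>: "\<And>x. \<alpha> $ x > 0" "real_adjacency E *v \<alpha> = r *\<^sub>R \<alpha>"
    and \<alpha>P: "\<And>x y. P x = P y \<Longrightarrow> \<alpha> $ x = \<alpha> $ y"
    using equitable_positive_eigenvector[OF conn cross deg] by blast
  obtain s p k where spk: "\<And>x y. real (card {z. E x z \<and> E z y})
    = s * of_bool (E x y) + p * of_bool (x = y) + k * (\<alpha> $ x * \<alpha> $ y)"
    using three_eigenvalue_common_neighbours[OF G \<alpha>] by blast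
  have colE: "E x y = E u v" if "pair_colour E P x y = pair_colour E P u v" for x y u v
  proof (cases "P x = P y")
    case False
    then show ?thesis using that cross[of x y] cross[of u v] by (auto simp: pair_colour_def)
  qed (use that in \<open>auto simp: pair_colour_def\<close>)
  have "card {z. E x z \<and> E z y} = card {z. E u z \<and> E z v}"
    if "pair_colour E P x y = pair_colour E P u v" for x y u v
  proof -
    have "real (card {z. E x z \<and> E z y}) = real (card {z. E u z \<and> E z v})"
      unfolding spk using colE[OF that] \<alpha>P[of x u] \<alpha>P[of y v] that
      by (simp add: pair_colour_def)
    then show ?thesis by simp
  qed
  from coherent_algebra_colour_matrices[OF sg cross deg this]
  have "coherent_algebra (colour_matrices E P)" by blast
  moreover have "adjacency_matrix E \<in> colour_matrices E P"
  proof (rule colour_matricesI)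
    fix x y u v assume "pair_colour E P x y = pair_colour E P u v"
    from colE[OF this] show "adjacency_matrix E $ x $ y = adjacency_matrix E $ u $ v"
      by (simp add: adjacency_matrix_def)
  qed
  ultimately have "coherent_closure E \<subseteq> colour_matrices E P" by (rule coherent_closure_least)
  then have "coherent_rank E \<le> card (range (\<lambda>p. pair_colour E P (fst p) (snd p)))"
    unfolding coherent_rank_def
    by (rule algebra_rank_le_colours[OF coherent_algebra_coherent_closure])
  then show ?thesis using card_pair_colours[OF sg, of P] by linarith
qed

lemma coherent_rank_three_vertices:
  fixes E :: "'v::finite \<Rightarrow> 'v \<Rightarrow> bool"
  assumes G: "three_eigenvalue_graph E" and card: "card (UNIV :: 'v set) = 3"
  shows "coherent_rank E \<le> 8"
proof -
  have conn: "connected_graph E" using G by (simp add: three_eigenvalue_graph_def)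
  then have "simple_graph E" by (simp add: connected_graph_def)
  then have sym: "E x y \<Longrightarrow> E y x" and irr: "\<not> E x x" for x y
    by (auto simp: simple_graph_def irreflp_def dest: sympD)
  have nb: "\<exists>z. E x z" if "x \<noteq> y" for x y
  proof -
    have "E\<^sup>*\<^sup>* x y" using conn by (simp add: connected_graph_def)
    then show ?thesis using that by (cases rule: converse_rtranclpE) auto
  qed
  obtain a b c where abc: "(UNIV :: 'v set) = {a, b, c}" "a \<noteq> b" "a \<noteq> c" "b \<noteq> c"
    using card by (auto simp: card_3_iff)
  have all: "w = a \<or> w = b \<or> w = c" for w using abc(1) by auto
  \<comment> \<open>A connected graph on three vertices has a vertex \<open>m\<close> adjacent to the two others.\<close>
  have "\<exists>m p q. (UNIV :: 'v set) = {m, p, q} \<and> m \<noteq> p \<and> m \<noteq> q \<and> p \<noteq> q \<and> E m p \<and> E m q"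
  proof -
    obtain a' b' c' where "E a a'" "E b b'" "E c c'" using nb abc by metis
    then consider "E a b" "E a c" | "E b a" "E b c" | "E c a" "E c b"
      using all[of a'] all[of b'] all[of c'] irr sym by blast
    then show ?thesis
    proof cases
      case 1
      then show ?thesis using abc by blast
    next
      case 2
      have "(UNIV :: 'v set) = {b, a, c}" using abc by auto
      then show ?thesis using 2 abc by blast
    next
      case 3
      have "(UNIV :: 'v set) = {c, a, b}" using abc by auto
      then show ?thesis using 3 abc by blast
    qed
  qed
  then obtain m p q where mpq: "(UNIV :: 'v set) = {m, p, q}" "m \<noteq> p" "m \<noteq> q" "p \<noteq> q"
    and E: "E m p" "E m q"
    by blast
  have all: "w = m \<or> w = p \<or> w = q" for w using mpq(1) by auto
  have Em: "E m x" "E x m" if "x \<noteq> m" for x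
    using all[of x] that E sym by blast+
  show ?thesis
  proof (rule coherent_rank_le_8[OF G, of "\<lambda>x. x = m" True])
    show "E x y = True" if "(x = m) \<noteq> (y = m)" for x y
      using that Em by auto
    have nbp: "{z. (z = m) = (p = m) \<and> E p z} = (if E p q then {q} else {})"
      using all irr mpq by auto
    have nbq: "{z. (z = m) = (q = m) \<and> E q z} = (if E p q then {p} else {})"
      using all irr mpq sym by auto
    show "card {z. (z = m) = (x = m) \<and> E x z} = card {z. (z = m) = (y = m) \<and> E y z}"
      if "(x = m) = (y = m)" for x y
    proof (cases "x = y")
      case False
      then have "x = p \<and> y = q \<or> x = q \<and> y = p" using that all[of x] all[of y] by auto
      then show ?thesis
      proof (elim disjE conjE)
        assume "x = p" "y = q"
        then show ?thesis unfolding \<open>x = p\<close> \<open>y = q\<close> nbp nbq by simp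
      next
        assume "x = q" "y = p"
        then show ?thesis unfolding \<open>x = q\<close> \<open>y = p\<close> nbp nbq by simp
      qed
    qed simp
  qed
qed

section \<open>Fibres and blocks of a coherent algebra\<close>

text \<open>The standard basis matrix with a nonzero entry at a given position.\<close>

definition basis_cell :: "(complex^'v^'v::finite) set \<Rightarrow> 'v \<Rightarrow> 'v \<Rightarrow> complex^'v^'v" where
  "basis_cell W x y = (THE M. M \<in> standard_basis W \<and> M $ x $ y = 1)"

text \<open>The fibre through a vertex: two vertices lie in the same fibre if and only if the same basis
  matrix covers their diagonal positions.\<close>

definition fibre_of :: "(complex^'v^'v::finite) set \<Rightarrow> 'v \<Rightarrow> 'v set" where
  "fibre_of W x = {y. basis_cell W y y = basis_cell W x x}"

lemma mem_fibre_of: "y \<in> fibre_of W x \<longleftrightarrow> fibre_of W y = fibre_of W x"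
  by (auto simp: fibre_of_def)

context
  fixes W :: "(complex^'v^'v::finite) set"
  assumes W: "coherent_algebra W"
begin

lemma basis_cell: "basis_cell W x y \<in> standard_basis W" "basis_cell W x y $ x $ y = 1"
proof -
  have "\<exists>!M. M \<in> standard_basis W \<and> M $ x $ y = 1"
    by (rule standard_basis_cell[OF is_standard_basis_standard_basis[OF W]])
  from theI'[OF this] show "basis_cell W x y \<in> standard_basis W" "basis_cell W x y $ x $ y = 1"
    by (simp_all add: basis_cell_def)
qed

lemma standard_basis_entry: "M \<in> standard_basis W \<Longrightarrow> M $ x $ y = 0 \<or> M $ x $ y = 1"
  using is_standard_basis_standard_basis[OF W]
  by (auto simp: is_standard_basis_def zero_one_matrix_iff)

lemma basis_cell_eqI:
  assumes "M \<in> standard_basis W" "M $ x $ y \<noteq> 0"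
  shows "basis_cell W x y = M"
proof (rule standard_basis_cell_unique[OF is_standard_basis_standard_basis[OF W]])
  show "M $ x $ y = 1" using standard_basis_entry[OF assms(1), of x y] assms(2) by simp
qed (rule basis_cell assms)+

lemma basis_cell_nth:
  "basis_cell W x y $ u $ v = (if basis_cell W x y = basis_cell W u v then 1 else 0)"
  using basis_cell(2)[of u v] basis_cell_eqI[OF basis_cell(1)[of x y], of u v]
  by (cases "basis_cell W x y $ u $ v = 0") auto

lemma standard_basis_cellE:
  assumes "M \<in> standard_basis W"
  obtains x y where "M = basis_cell W x y"
proof -
  have "M \<noteq> 0"
    using is_standard_basis_standard_basis[OF W] assms cmat.dependent_zero
    by (auto simp: is_standard_basis_def)
  then obtain x y where "M $ x $ y \<noteq> 0" by (auto simp: vec_eq_iff)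
  then show ?thesis using basis_cell_eqI[OF assms] that by metis
qed

lemma basis_cell_in_algebra: "basis_cell W x y \<in> W"
  using is_standard_basis_standard_basis[OF W] basis_cell(1) cmat.span_base
  unfolding is_standard_basis_def by blast

lemma basis_cell_constant:
  assumes "N \<in> W" "basis_cell W x y = basis_cell W u v"
  shows "N $ x $ y = N $ u $ v"
  using standard_basis_constant[OF is_standard_basis_standard_basis[OF W] assms(1)
      basis_cell(1)[of x y] basis_cell(2)] basis_cell(2)[of u v] assms(2)
  by simp

lemma basis_cell_diagonal: "basis_cell W x x = basis_cell W u v \<Longrightarrow> u = v"
  using basis_cell_constant[of "mat 1" x x u v] W
  by (auto simp: coherent_algebra_def mat_def split: if_splits)

lemma fibre_matrix_nth:
  "basis_cell W x x $ u $ v = (if u = v \<and> u \<in> fibre_of W x then 1 else 0)"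
  using basis_cell_diagonal[of x u v] by (auto simp: basis_cell_nth fibre_of_def)

lemma diagonal_entry_constant:
  assumes "N \<in> W" "fibre_of W x = fibre_of W u"
  shows "N $ x $ x = N $ u $ u"
  by (rule basis_cell_constant) (use assms mem_fibre_of[of x W u] in \<open>auto simp: fibre_of_def\<close>)

lemma mult_fibre_matrix:
  "(basis_cell W a a ** N) $ x $ y = (if x \<in> fibre_of W a then N $ x $ y else 0)"
  "(N ** basis_cell W a a) $ x $ y = (if y \<in> fibre_of W a then N $ x $ y else 0)"
proof -
  have "basis_cell W a a $ x $ z * N $ z $ y =
      (if z = x then if x \<in> fibre_of W a then N $ x $ y else 0 else 0)" for z
    by (simp add: fibre_matrix_nth)
  then show "(basis_cell W a a ** N) $ x $ y = (if x \<in> fibre_of W a then N $ x $ y else 0)"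
    by (simp add: matrix_matrix_mult_def)
  have "N $ x $ z * basis_cell W a a $ z $ y =
      (if z = y then if y \<in> fibre_of W a then N $ x $ y else 0 else 0)" for z
    by (simp add: fibre_matrix_nth)
  then show "(N ** basis_cell W a a) $ x $ y = (if y \<in> fibre_of W a then N $ x $ y else 0)"
    by (simp add: matrix_matrix_mult_def)
qed

text \<open>Each basis matrix lies in a single block: multiplying it by the diagonal matrix of a fibre, on
  either side, stays in the algebra and so cannot cut its support.\<close>

lemma basis_cell_fibre_of:
  assumes eq: "basis_cell W x y = basis_cell W u v"
  shows "fibre_of W x = fibre_of W u" "fibre_of W y = fibre_of W v"
proof -
  have prod: "M ** N \<in> W" if "M \<in> W" "N \<in> W" for M N
    using W that by (auto simp: coherent_algebra_def)
  note cell = basis_cell_in_algebra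
  have "(basis_cell W x x ** basis_cell W x y) $ u $ v = 1"
    using basis_cell_constant[OF prod[OF cell[of x x] cell[of x y]] eq]
    by (simp add: mult_fibre_matrix basis_cell mem_fibre_of)
  then show "fibre_of W x = fibre_of W u"
    by (auto simp: mult_fibre_matrix mem_fibre_of split: if_splits)
  have "(basis_cell W x y ** basis_cell W y y) $ u $ v = 1"
    using basis_cell_constant[OF prod[OF cell[of x y] cell[of y y]] eq]
    by (simp add: mult_fibre_matrix basis_cell mem_fibre_of)
  then show "fibre_of W y = fibre_of W v"
    by (auto simp: mult_fibre_matrix mem_fibre_of split: if_splits)
qed

lemma transpose_basis_cell: "transpose (basis_cell W x y) = basis_cell W y x"
proof -
  have *: "basis_cell W y x = basis_cell W v u"
    if "basis_cell W x y = basis_cell W u v" for x y u v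
  proof -
    have "transpose (basis_cell W y x) \<in> W"
      using W basis_cell_in_algebra by (auto simp: coherent_algebra_def)
    from basis_cell_constant[OF this that] have "basis_cell W y x $ v $ u = 1"
      by (simp add: transpose_def basis_cell)
    then show ?thesis using basis_cell_eqI[OF basis_cell(1)[of y x], of v u] by simp
  qed
  have "basis_cell W x y = basis_cell W u v \<longleftrightarrow> basis_cell W y x = basis_cell W v u" for u v
    using * by blast
  then have "transpose (basis_cell W x y) $ u $ v = basis_cell W y x $ u $ v" for u v
    by (simp add: transpose_def basis_cell_nth)
  then show ?thesis unfolding vec_eq_iff by blast
qed

lemma row_sum_constant:
  assumes "N \<in> W" "fibre_of W x = fibre_of W u"
  shows "(\<Sum>y\<in>UNIV. N $ x $ y) = (\<Sum>y\<in>UNIV. N $ u $ y)"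
proof -
  have "N ** all_ones \<in> W" using W assms(1) by (auto simp: coherent_algebra_def)
  from diagonal_entry_constant[OF this assms(2)] show ?thesis
    by (simp add: matrix_matrix_mult_def all_ones_def)
qed

lemma fibre_degree_constant:
  assumes A: "adjacency_matrix E \<in> W" and eq: "fibre_of W x = fibre_of W u"
  shows "card {z \<in> fibre_of W a. E x z} = card {z \<in> fibre_of W a. E u z}"
proof -
  let ?N = "adjacency_matrix E ** basis_cell W a a"
  have N: "?N \<in> W" using W A basis_cell_in_algebra by (auto simp: coherent_algebra_def)
  have "(\<Sum>y\<in>UNIV. ?N $ w $ y) = of_nat (card {z \<in> fibre_of W a. E w z})" for w
  proof -
    have "(\<Sum>y\<in>UNIV. ?N $ w $ y) = (\<Sum>y\<in>UNIV. if y \<in> fibre_of W a \<and> E w y then 1 else 0)"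
      by (rule sum.cong) (auto simp: mult_fibre_matrix adjacency_matrix_def)
    then show ?thesis by (simp add: sum.If_cases)
  qed
  then have "(of_nat (card {z \<in> fibre_of W a. E x z}) :: complex)
      = of_nat (card {z \<in> fibre_of W a. E u z})"
    using row_sum_constant[OF N eq] by simp
  then show ?thesis by (simp only: of_nat_eq_iff)
qed

lemma fibres_eq: "fibres W = range (fibre_of W)"
proof -
  have diag: "M \<in> standard_basis W \<and> diagonal_matrix M \<longleftrightarrow> (\<exists>x. M = basis_cell W x x)" for M
  proof
    assume M: "M \<in> standard_basis W \<and> diagonal_matrix M"
    then obtain x y where xy: "M = basis_cell W x y" using standard_basis_cellE by blast
    then have "x = y" using M basis_cell(2)[of x y] by (cases "x = y") (simp_all add: diagonal_matrix_def)
    then show "\<exists>x. M = basis_cell W x x" using xy by blast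
  next
    assume "\<exists>x. M = basis_cell W x x"
    then show "M \<in> standard_basis W \<and> diagonal_matrix M"
      by (auto simp: diagonal_matrix_def fibre_matrix_nth basis_cell)
  qed
  have supp: "{y. basis_cell W x x $ y $ y \<noteq> 0} = fibre_of W x" for x
    by (auto simp: fibre_matrix_nth)
  show ?thesis unfolding fibres_def diag using supp by blast
qed

lemma block_eq:
  "{M \<in> standard_basis W. \<forall>x y. M $ x $ y \<noteq> 0 \<longrightarrow> x \<in> fibre_of W a \<and> y \<in> fibre_of W b}
    = (\<lambda>(u, v). basis_cell W u v) ` (fibre_of W a \<times> fibre_of W b)" (is "?L = ?R")
proof
  show "?L \<subseteq> ?R"
  proof
    fix M assume M: "M \<in> ?L"
    then obtain u v where "M = basis_cell W u v" using standard_basis_cellE by blast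
    then show "M \<in> ?R" using M basis_cell(2)[of u v] by force
  qed
  show "?R \<subseteq> ?L"
  proof (clarify, intro conjI allI impI CollectI)
    fix u v x y assume uv: "u \<in> fibre_of W a" "v \<in> fibre_of W b"
    show "basis_cell W u v \<in> standard_basis W" by (rule basis_cell)
    assume "basis_cell W u v $ x $ y \<noteq> 0"
    then have "basis_cell W u v = basis_cell W x y" by (simp add: basis_cell_nth split: if_splits)
    from basis_cell_fibre_of[OF this] uv
    show "x \<in> fibre_of W a" "y \<in> fibre_of W b" by (simp_all add: mem_fibre_of)
  qed
qed

lemma block_count_eq:
  "block_count W (fibre_of W a) (fibre_of W b)
    = card ((\<lambda>(u, v). basis_cell W u v) ` (fibre_of W a \<times> fibre_of W b))"
  unfolding block_count_def block_eq ..

lemma block_count_commute: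
  "block_count W (fibre_of W a) (fibre_of W b) = block_count W (fibre_of W b) (fibre_of W a)"
proof -
  define S where "S = (\<lambda>(u, v). basis_cell W u v) ` (fibre_of W a \<times> fibre_of W b)"
  have "(\<lambda>(u, v). basis_cell W u v) ` (fibre_of W b \<times> fibre_of W a)
      = (\<lambda>(u, v). basis_cell W v u) ` (fibre_of W a \<times> fibre_of W b)"
    by (auto intro: rev_image_eqI)
  also have "\<dots> = transpose ` S"
    unfolding S_def image_image by (rule image_cong) (auto simp: transpose_basis_cell)
  finally have eq: "block_count W (fibre_of W b) (fibre_of W a) = card (transpose ` S)"
    by (simp only: block_count_eq)
  have "inj_on transpose S" by (rule inj_on_inverseI[of _ transpose]) (rule transpose_transpose)
  then show ?thesis unfolding eq by (simp only: card_image block_count_eq S_def)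
qed

lemma block_count_pos: "block_count W (fibre_of W a) (fibre_of W b) \<ge> 1"
proof -
  have "basis_cell W a b \<in> (\<lambda>(u, v). basis_cell W u v) ` (fibre_of W a \<times> fibre_of W b)"
    by (rule image_eqI[of _ _ "(a, b)"]) (simp_all add: mem_fibre_of)
  then show ?thesis
    unfolding block_count_eq by (auto simp: Suc_le_eq card_gt_0_iff)
qed

lemma block_count_one:
  assumes "block_count W (fibre_of W a) (fibre_of W b) = 1"
    and "x \<in> fibre_of W a" "u \<in> fibre_of W a" "y \<in> fibre_of W b" "v \<in> fibre_of W b"
  shows "basis_cell W x y = basis_cell W u v"
proof -
  obtain M where M: "(\<lambda>(u, v). basis_cell W u v) ` (fibre_of W a \<times> fibre_of W b) = {M}"
    using assms(1) unfolding block_count_eq by (rule card_1_singletonE)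
  have "basis_cell W x y \<in> {M}"
    unfolding M[symmetric] by (rule image_eqI[of _ _ "(x, y)"]) (simp_all add: assms)
  moreover have "basis_cell W u v \<in> {M}"
    unfolding M[symmetric] by (rule image_eqI[of _ _ "(u, v)"]) (simp_all add: assms)
  ultimately show ?thesis by simp
qed

text \<open>The block of a fibre with at least two vertices contains both a diagonal and a nondiagonal basis
  matrix.\<close>

lemma block_count_diagonal:
  assumes "block_count W (fibre_of W a) (fibre_of W a) = 1"
  shows "fibre_of W a = {a}"
proof -
  have a: "a \<in> fibre_of W a" by (simp add: mem_fibre_of)
  have "x = a" if "x \<in> fibre_of W a" for x
    using basis_cell_diagonal[OF block_count_one[OF assms a a a that]] by simp
  then show ?thesis using a by blast
qed

text \<open>Column sums of a basis matrix are constant on a fibre. If the rows come from a singleton fibre,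
  a column in the block has a single entry, so a basis matrix fills the whole block.\<close>

lemma block_count_singleton:
  assumes sing: "fibre_of W a = {a}"
  shows "block_count W (fibre_of W a) (fibre_of W b) = 1"
proof -
  have "basis_cell W a v = basis_cell W a b" if v: "v \<in> fibre_of W b" for v
  proof -
    \<comment> \<open>The transposed matrix is used, so that row sums apply.\<close>
    let ?N = "basis_cell W b a"
    have "?N \<in> W" by (rule basis_cell_in_algebra)
    then have "(\<Sum>z\<in>UNIV. ?N $ v $ z) = (\<Sum>z\<in>UNIV. ?N $ b $ z)"
      by (rule row_sum_constant) (use v in \<open>simp add: mem_fibre_of\<close>)
    moreover have "(\<Sum>z\<in>UNIV. ?N $ w $ z) = ?N $ w $ a" for w
    proof -
      have "?N $ w $ z = 0" if "z \<noteq> a" for z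
      proof (rule ccontr)
        assume "?N $ w $ z \<noteq> 0"
        then have "?N = basis_cell W w z" by (simp add: basis_cell_nth split: if_splits)
        from basis_cell_fibre_of(2)[OF this] have "z \<in> fibre_of W a" by (simp add: mem_fibre_of)
        then show False using sing that by simp
      qed
      then have "(\<Sum>z\<in>UNIV. ?N $ w $ z) = (\<Sum>z\<in>{a}. ?N $ w $ z)"
        by (intro sum.mono_neutral_right) auto
      then show ?thesis by simp
    qed
    ultimately have "?N $ v $ a = 1" by (simp add: basis_cell)
    then have "basis_cell W v a = ?N" by (intro basis_cell_eqI basis_cell(1)) simp
    then have "transpose (basis_cell W v a) = transpose ?N" by (rule arg_cong)
    then show ?thesis by (simp only: transpose_basis_cell)
  qed
  then have "(\<lambda>(u, v). basis_cell W u v) ` (fibre_of W a \<times> fibre_of W b) \<subseteq> {basis_cell W a b}"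
    unfolding sing by auto
  then have "block_count W (fibre_of W a) (fibre_of W b) \<le> card {basis_cell W a b}"
    unfolding block_count_eq by (rule card_mono[rotated]) simp
  then show ?thesis using block_count_pos[of a b] by simp
qed

lemma algebra_rank_eq_sum_block_count:
  "algebra_rank W = (\<Sum>F\<in>fibres W. \<Sum>G\<in>fibres W. block_count W F G)"
proof -
  define blk where
    "blk p = (\<lambda>(u, v). basis_cell W u v) ` (fst p \<times> snd p)" for p :: "'v set \<times> 'v set"
  have union: "standard_basis W = (\<Union>p\<in>fibres W \<times> fibres W. blk p)"
  proof
    show "standard_basis W \<subseteq> (\<Union>p\<in>fibres W \<times> fibres W. blk p)"
    proof
      fix M assume "M \<in> standard_basis W"
      then obtain x y where "M = basis_cell W x y" by (rule standard_basis_cellE)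
      then have "M \<in> blk (fibre_of W x, fibre_of W y)"
        unfolding blk_def by (intro image_eqI[of _ _ "(x, y)"]) (simp_all add: mem_fibre_of)
      then show "M \<in> (\<Union>p\<in>fibres W \<times> fibres W. blk p)" by (auto simp: fibres_eq)
    qed
    show "(\<Union>p\<in>fibres W \<times> fibres W. blk p) \<subseteq> standard_basis W"
      using basis_cell(1) unfolding blk_def by auto
  qed
  have "finite (blk p)" for p by (simp add: blk_def)
  moreover have "blk p \<inter> blk q = {}"
    if pq: "p \<in> fibres W \<times> fibres W" "q \<in> fibres W \<times> fibres W" "p \<noteq> q" for p q
  proof (rule ccontr)
    assume "blk p \<inter> blk q \<noteq> {}"
    then obtain M where M: "M \<in> blk p" "M \<in> blk q" by blast
    obtain a b where p: "p = (fibre_of W a, fibre_of W b)"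
      using pq(1) unfolding fibres_eq by blast
    obtain c d where q: "q = (fibre_of W c, fibre_of W d)"
      using pq(2) unfolding fibres_eq by blast
    obtain x y where xy: "M = basis_cell W x y" "x \<in> fibre_of W a" "y \<in> fibre_of W b"
      using M(1) by (auto simp: blk_def p)
    obtain u v where uv: "M = basis_cell W u v" "u \<in> fibre_of W c" "v \<in> fibre_of W d"
      using M(2) by (auto simp: blk_def q)
    have "p = q" using basis_cell_fibre_of[OF trans[OF xy(1)[symmetric] uv(1)]] xy(2,3) uv(2,3)
      by (simp add: mem_fibre_of p q)
    then show False using pq by blast
  qed
  ultimately have "algebra_rank W = (\<Sum>p\<in>fibres W \<times> fibres W. card (blk p))"
    unfolding algebra_rank_def union by (intro card_UN_disjoint ballI impI finite) assumption+
  also have "\<dots> = (\<Sum>p\<in>fibres W \<times> fibres W. block_count W (fst p) (snd p))"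
    by (rule sum.cong) (auto simp: fibres_eq blk_def block_count_eq)
  finally show ?thesis by (simp add: sum.cartesian_product case_prod_beta)
qed

end

section \<open>Coherent rank nine\<close>

theorem theorem5p6:
  fixes E :: "'v::finite \<Rightarrow> 'v \<Rightarrow> bool"
  assumes "three_eigenvalue_graph E"
    and "coherent_rank E = 9"
  shows "has_type (coherent_closure E) [[2, 2], [2, 3]]"
proof -
  define W where "W = coherent_closure E"
  have W: "coherent_algebra W" unfolding W_def by (rule coherent_algebra_coherent_closure)
  have A: "adjacency_matrix E \<in> W" unfolding W_def by (rule adjacency_matrix_in_coherent_closure)
  have sym: "E x y = E y x" for x y
    using assms(1)
    by (auto simp: three_eigenvalue_graph_def connected_graph_def simple_graph_def dest: sympD)
  have not_le_8: "\<not> coherent_rank E \<le> 8" using assms(2) by simp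
  let ?t = "block_count W"
  have sum9: "(\<Sum>F\<in>fibres W. \<Sum>G\<in>fibres W. ?t F G) = 9"
    using assms(2) algebra_rank_eq_sum_block_count[OF W] by (simp add: coherent_rank_def W_def)
  have pos: "1 \<le> ?t F G" if "F \<in> fibres W" "G \<in> fibres W" for F G
    using that block_count_pos[OF W] by (auto simp: fibres_eq[OF W])
  define f where "f = card (fibres W)"
  have "(\<Sum>F\<in>fibres W. \<Sum>G\<in>fibres W. 1) \<le> (\<Sum>F\<in>fibres W. \<Sum>G\<in>fibres W. ?t F G)"
    by (intro sum_mono pos)
  then have ff: "f * f \<le> 9" by (simp add: sum9 f_def)
  have "f \<le> 3"
  proof (rule ccontr)
    assume "\<not> f \<le> 3"
    then have "4 * 4 \<le> f * f" by (intro mult_le_mono) auto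
    then show False using ff by simp
  qed
  moreover have "f \<noteq> 0" using sum9 by (auto simp: f_def)
  ultimately consider "f = 1" | "f = 3" | "f = 2" by linarith
  then show ?thesis
  proof cases
    case 1
    then obtain F where "fibres W = {F}" unfolding f_def by (rule card_1_singletonE)
    then have F: "fibre_of W x = F" for x unfolding fibres_eq[OF W] by blast
    then have "F = UNIV" using mem_fibre_of[of _ W] by blast
    have "card {z. E x z} = card {z. E y z}" for x y
      using fibre_degree_constant[OF W A, of x y] F \<open>F = UNIV\<close> by simp
    then have "coherent_rank E \<le> 8"
      by (intro coherent_rank_le_8[OF assms(1), of "\<lambda>_. True"]) auto
    then show ?thesis using not_le_8 by blast
  next
    case 2
    have one: "?t F G = 1" if "F \<in> fibres W" "G \<in> fibres W" for F G
    proof (rule ccontr)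
      assume "?t F G \<noteq> 1"
      then have less: "1 < ?t F G" using pos[OF that] by simp
      have "(\<Sum>F\<in>fibres W. \<Sum>G\<in>fibres W. 1) < (\<Sum>F\<in>fibres W. \<Sum>G\<in>fibres W. ?t F G)"
        unfolding sum.cartesian_product
        by (rule sum_strict_mono_ex1) (use pos that less in auto)
      then show False using 2 by (simp add: sum9 f_def)
    qed
    then have "fibre_of W x = {x}" for x
      by (intro block_count_diagonal[OF W]) (auto simp: fibres_eq[OF W])
    then have "fibres W = range (\<lambda>x. {x})" by (simp add: fibres_eq[OF W])
    then have "card (UNIV :: 'v set) = 3"
      using 2 by (simp add: f_def card_image inj_on_def)
    then show ?thesis using coherent_rank_three_vertices[OF assms(1)] not_le_8 by blast
  next
    case 3
    then have "card (fibres W) = 2" by (simp add: f_def)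
    then obtain F G where FG: "fibres W = {F, G}" "F \<noteq> G" unfolding card_2_iff by blast
    have "F \<in> range (fibre_of W)" "G \<in> range (fibre_of W)"
      unfolding fibres_eq[OF W, symmetric] FG by simp_all
    then obtain a b where F: "F = fibre_of W a" and G: "G = fibre_of W b" by blast
    have cases: "fibre_of W x = F \<or> fibre_of W x = G" for x
    proof -
      have "fibre_of W x \<in> {F, G}" unfolding FG(1)[symmetric] fibres_eq[OF W] by simp
      then show ?thesis by simp
    qed
    have tGF: "?t G F = ?t F G" unfolding F G by (rule block_count_commute[OF W])
    have sum: "?t F F + 2 * ?t F G + ?t G G = 9"
      using sum9 FG by (simp add: tGF)
    have "?t F G \<noteq> 1"
    proof
      assume t1: "?t F G = 1"
      have inF: "x \<in> F \<longleftrightarrow> fibre_of W x = F" for x unfolding F by (rule mem_fibre_of)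
      have "x \<in> G \<longleftrightarrow> fibre_of W x = G" for x unfolding G by (rule mem_fibre_of)
      then have inG: "x \<notin> F \<longleftrightarrow> x \<in> G" for x using inF cases FG(2) by metis
      have adj: "E x y = E a b" if "x \<in> F" "y \<notin> F" for x y
      proof -
        have "basis_cell W x y = basis_cell W a b"
          by (rule block_count_one[OF W t1[unfolded F G]])
            (use that inG[of y] in \<open>simp_all add: F G mem_fibre_of[of a] mem_fibre_of[of b]\<close>)
        from basis_cell_constant[OF W A this] show ?thesis
          by (auto simp: adjacency_matrix_def split: if_splits)
      qed
      have "coherent_rank E \<le> 8"
      proof (rule coherent_rank_le_8[OF assms(1), of "\<lambda>x. x \<in> F" "E a b"])
        show "E x y = E a b" if "(x \<in> F) \<noteq> (y \<in> F)" for x y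
          using that adj[of x y] adj[of y x] sym[of x y] by blast
        show "card {z. (z \<in> F) = (x \<in> F) \<and> E x z} = card {z. (z \<in> F) = (y \<in> F) \<and> E y z}"
          if "(x \<in> F) = (y \<in> F)" for x y
        proof -
          have eq: "fibre_of W x = fibre_of W y" using that inF cases by metis
          show ?thesis
          proof (cases "x \<in> F")
            case True
            then show ?thesis
              using that fibre_degree_constant[OF W A eq, of a] by (simp add: F)
          next
            case False
            then have "{z. (z \<in> F) = (w \<in> F) \<and> E w z} = {z \<in> G. E w z}" if "w \<notin> F" for w
              using that inG by blast
            then show ?thesis
              using False that fibre_degree_constant[OF W A eq, of b] by (simp add: G)
          qed
        qed
      qed
      then show False using not_le_8 by blast
    qed
    moreover have "1 \<le> ?t F G" "1 \<le> ?t F F" "1 \<le> ?t G G" using pos FG by auto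
    moreover have "?t F F \<noteq> 1"
    proof
      assume "?t F F = 1"
      then have "F = {a}" unfolding F by (rule block_count_diagonal[OF W])
      then have "?t F G = 1" unfolding F G by (intro block_count_singleton[OF W])
      then show False using \<open>?t F G \<noteq> 1\<close> by simp
    qed
    moreover have "?t G G \<noteq> 1"
    proof
      assume "?t G G = 1"
      then have "G = {b}" unfolding G by (rule block_count_diagonal[OF W])
      then have "?t G F = 1" unfolding F G by (intro block_count_singleton[OF W])
      then show False using \<open>?t F G \<noteq> 1\<close> tGF by simp
    qed
    moreover have "n = 2 \<and> (m = 2 \<and> k = 3 \<or> m = 3 \<and> k = 2)"
      if "n \<noteq> 1" "1 \<le> n" "1 \<le> m" "1 \<le> k" "m \<noteq> 1" "k \<noteq> 1" "m + 2 * n + k = 9" for m n k :: nat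
      using that by presburger
    ultimately have "?t F G = 2 \<and> (?t F F = 2 \<and> ?t G G = 3 \<or> ?t F F = 3 \<and> ?t G G = 2)"
      using sum by blast
    then have "\<exists>Fs. distinct Fs \<and> set Fs = fibres W \<and> [[2, 2], [2, 3]] = map (\<lambda>F. map (?t F) Fs) Fs"
    proof (elim disjE conjE)
      assume "?t F G = 2" "?t F F = 2" "?t G G = 3"
      then show ?thesis using FG tGF by (intro exI[of _ "[F, G]"]) simp
    next
      assume "?t F G = 2" "?t F F = 3" "?t G G = 2"
      then show ?thesis using FG tGF by (intro exI[of _ "[G, F]"]) auto
    qed
    then show ?thesis unfolding has_type_def W_def .
  qed
qed

end
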